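(* Let $n$ be a positive integer. The intersection graph of ideals $G(\mathbb{Z}_n)$ is perfect if and only if $n={p_1}^{\alpha_1}{p_2}^{\alpha_2}{p_3}^{\alpha_3}{p_4}^{\alpha_4}$ for some distinct primes $p_1,p_2,p_3,p_4$ and some $\alpha_1,\alpha_2,\alpha_3,\alpha_4 \in \mathbb{N}\cup\{0\}$, i.e., if and only if the number of distinct prime factors of $n$ is less than or equal to $4$.
   Context: $\mathbb{Z}_n$ is the ring of integers modulo $n$. For a ring $R$, the intersection graph of ideals $G(R)$ is the simple graph whose vertices are the non-trivial ideals of $R$ (those different from $\{0\}$ and $R$), where two distinct vertices $I$ and $J$ are adjacent if and only if $I\cap J\neq\{0\}$. A graph $G$ is perfect if $\omega(H)=\chi(H)$ for every induced subgraph $H$ of $G$, where $\omega$ is the clique number and $\chi$ the chromatic number. The graph with no vertices (which occurs as $G(\mathbb{Z}_n)$ when $n=1$ or $n$ is prime) is regarded as perfect. *)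

theory Defs
  imports
    "HOL-Algebra.IntRing"
    "HOL-Computational_Algebra.Primes"
    "Graph_Theory.Digraph_Component"
begin

text \<open>
  As in the Graph_Theory library, a simple graph is a symmetric digraph without loops and
  without parallel arcs; an undirected edge is a pair of opposite arcs. The null graph is allowed.
\<close>

definition intersection_graph :: "('a, 'm) ring_scheme \<Rightarrow> 'a set pair_pre_digraph" where
  "intersection_graph R =
    (let V = {I. ideal I R \<and> I \<noteq> {\<zero>\<^bsub>R\<^esub>} \<and> I \<noteq> carrier R} in
      \<lparr>pverts = V,
       parcs = {(I, J). I \<in> V \<and> J \<in> V \<and> I \<noteq> J \<and> I \<inter> J \<noteq> {\<zero>\<^bsub>R\<^esub>}}\<rparr>)"

lemma pair_graph_intersection_graph:
  assumes "finite (carrier R)"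
  shows "pair_graph (intersection_graph R)"
proof -
  let ?G = "intersection_graph R"
  have V: "I \<in> pverts ?G \<longleftrightarrow> ideal I R \<and> I \<noteq> {\<zero>\<^bsub>R\<^esub>} \<and> I \<noteq> carrier R" for I
    by (simp add: intersection_graph_def Let_def)
  have E: "e \<in> parcs ?G \<longleftrightarrow> fst e \<in> pverts ?G \<and> snd e \<in> pverts ?G \<and>
      fst e \<noteq> snd e \<and> fst e \<inter> snd e \<noteq> {\<zero>\<^bsub>R\<^esub>}" for e
    by (simp add: intersection_graph_def Let_def case_prod_beta)
  have "pverts ?G \<subseteq> Pow (carrier R)"
    using V ideal.axioms(1) additive_subgroup.a_subset by (metis Pow_iff subsetI)
  then have finV: "finite (pverts ?G)"
    using assms by (meson finite_Pow_iff finite_subset)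
  have "parcs ?G \<subseteq> pverts ?G \<times> pverts ?G"
    using E by (metis SigmaI prod.collapse subsetI)
  then have finE: "finite (parcs ?G)"
    using finV by (meson finite_SigmaI finite_subset)
  have "sym (parcs ?G)"
    by (rule symI) (auto simp: E Int_commute)
  then have sym: "symmetric (with_proj ?G)"
    by (simp add: symmetric_def)
  show ?thesis
    by (unfold_locales; (rule finV finE sym | simp add: E))
qed

definition clique :: "('a, 'b) pre_digraph \<Rightarrow> 'a set \<Rightarrow> bool" where
  "clique G K \<longleftrightarrow> K \<subseteq> verts G \<and> (\<forall>u \<in> K. \<forall>v \<in> K. u \<noteq> v \<longrightarrow> u \<rightarrow>\<^bsub>G\<^esub> v)"

definition proper_coloring :: "('a, 'b) pre_digraph \<Rightarrow> ('a \<Rightarrow> nat) \<Rightarrow> nat \<Rightarrow> bool" where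
  "proper_coloring G c k \<longleftrightarrow>
    (\<forall>v \<in> verts G. c v < k) \<and>
    (\<forall>u \<in> verts G. \<forall>v \<in> verts G. u \<rightarrow>\<^bsub>G\<^esub> v \<longrightarrow> c u \<noteq> c v)"

text \<open>
  The next three definitions are meaningful for finite graphs only: otherwise the maximum and
  the minimum need not exist.
\<close>

definition clique_number :: "('a, 'b) pre_digraph \<Rightarrow> nat" where
  "clique_number G = Max (card ` {K. clique G K})"

definition chromatic_number :: "('a, 'b) pre_digraph \<Rightarrow> nat" where
  "chromatic_number G = (LEAST k. \<exists>c. proper_coloring G c k)"

definition perfect_graph :: "('a, 'b) pre_digraph \<Rightarrow> bool" where
  "perfect_graph G \<longleftrightarrow>
    (\<forall>H. induced_subgraph H G \<longrightarrow> clique_number H = chromatic_number H)"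

end

theory Submission
  imports Defs
begin

text \<open>
  Label an ideal of $\mathbb{Z}_n$ by the set of primes \<open>p\<close> for which it contains the minimal ideal
  generated by \<open>n/p\<close>. Labels of nonzero ideals are nonempty and turn intersections of ideals into
  intersections of labels, so two ideals are adjacent iff their labels meet.

  If there are five primes, the ideals generated by \<open>n/(p\<^sub>i p\<^sub>i\<^sub>+\<^sub>1)\<close>, indices modulo 5, induce a 5-cycle,
  which is not perfect. If there are at most four, a vertex whose label is a singleton is simplicial
  and can be coloured last. If no label is a singleton, then disjoint labels are complementary, so
  every maximum clique contains one vertex of each nonadjacent pair; such a pair becomes
  a colour class and the clique number of the rest drops.
\<close>

section \<open>Clique number, chromatic number and perfection of finite graphs\<close>

lemma maximum_cliqueE:
  assumes "finite (verts G)"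
  obtains K where "clique G K" "card K = clique_number G"
    "\<And>K'. clique G K' \<Longrightarrow> card K' \<le> clique_number G"
proof -
  have "{K. clique G K} \<subseteq> Pow (verts G)"
    by (auto simp: clique_def)
  then have fin: "finite {K. clique G K}"
    using assms by (meson finite_Pow_iff finite_subset)
  \<comment> \<open>The empty clique keeps the range of \<open>Max\<close> nonempty, also for the
    null graph.\<close>
  have "clique G {}"
    by (simp add: clique_def)
  then have "Max (card ` {K. clique G K}) \<in> card ` {K. clique G K}"
    using fin by (intro Max_in) auto
  moreover have "card K \<le> Max (card ` {K. clique G K})" if "clique G K" for K
    using fin that by (intro Max_ge) auto
  ultimately show thesis
    using that by (auto simp: clique_number_def)
qed

text \<open>The vertices of a maximum clique need different colours, so a proper colouring never has
  fewer than \<open>clique_number G\<close> colours; equality thus means that this many suffice.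
  Numbering the vertices injectively is a proper colouring of a loopless graph, so the
  \<open>LEAST\<close> is attained.\<close>

lemma clique_number_eq_chromatic_number_iff:
  assumes "finite (verts G)" "\<And>v. \<not> v \<rightarrow>\<^bsub>G\<^esub> v"
  shows "clique_number G = chromatic_number G \<longleftrightarrow> (\<exists>c. proper_coloring G c (clique_number G))"
proof
  obtain h where "bij_betw h (verts G) {0..<card (verts G)}"
    using ex_bij_betw_finite_nat[OF assms(1)] by blast
  then have "proper_coloring G h (card (verts G))"
    using assms(2) unfolding proper_coloring_def bij_betw_def
    by (metis atLeastLessThan_iff image_eqI inj_onD)
  then have "\<exists>c. proper_coloring G c (chromatic_number G)"
    unfolding chromatic_number_def by (intro LeastI[of "\<lambda>k. \<exists>c. proper_coloring G c k"] exI)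
  then show "\<exists>c. proper_coloring G c (clique_number G)"
    if "clique_number G = chromatic_number G"
    using that by simp
  assume "\<exists>c. proper_coloring G c (clique_number G)"
  moreover have "clique_number G \<le> k" if colorable: "\<exists>c. proper_coloring G c k" for k
  proof -
    obtain c where c: "proper_coloring G c k"
      using colorable by blast
    obtain K where K: "clique G K" "card K = clique_number G"
      using maximum_cliqueE[OF assms(1)] by metis
    have "inj_on c K" "c ` K \<subseteq> {..<k}"
      using c K(1) unfolding proper_coloring_def clique_def inj_on_def by blast+
    then show ?thesis
      using card_inj_on_le[of c K "{..<k}"] K(2) by simp
  qed
  ultimately show "clique_number G = chromatic_number G"
    unfolding chromatic_number_def by (rule Least_equality[symmetric])
qed

text \<open>An induced subgraph keeps all adjacencies between its vertices, so its cliques and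
  colourings can be described by adjacency in \<open>G\<close>.\<close>

lemma
  assumes "induced_subgraph H G"
  shows induced_subgraph_dominates_iff:
      "\<lbrakk>u \<in> verts H; v \<in> verts H\<rbrakk> \<Longrightarrow> u \<rightarrow>\<^bsub>H\<^esub> v \<longleftrightarrow> u \<rightarrow>\<^bsub>G\<^esub> v"
    and induced_subgraph_clique_iff: "clique H K \<longleftrightarrow> K \<subseteq> verts H \<and> clique G K"
    and induced_subgraph_proper_coloring_iff: "proper_coloring H c k \<longleftrightarrow>
      (\<forall>v\<in>verts H. c v < k) \<and> (\<forall>u\<in>verts H. \<forall>v\<in>verts H. u \<rightarrow>\<^bsub>G\<^esub> v \<longrightarrow> c u \<noteq> c v)"
proof -
  have dom: "u \<rightarrow>\<^bsub>H\<^esub> v \<longleftrightarrow> u \<rightarrow>\<^bsub>G\<^esub> v" if "u \<in> verts H" "v \<in> verts H" for u v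
    using assms that
    by (auto simp: induced_subgraph_def subgraph_def compatible_def arcs_ends_conv)
  then show "\<lbrakk>u \<in> verts H; v \<in> verts H\<rbrakk> \<Longrightarrow> u \<rightarrow>\<^bsub>H\<^esub> v \<longleftrightarrow> u \<rightarrow>\<^bsub>G\<^esub> v" .
  have "verts H \<subseteq> verts G"
    using assms by (intro subgraph_imp_subverts induced_imp_subgraph)
  then show "clique H K \<longleftrightarrow> K \<subseteq> verts H \<and> clique G K"
    by (auto simp: clique_def dom subset_iff)
  show "proper_coloring H c k \<longleftrightarrow>
      (\<forall>v\<in>verts H. c v < k) \<and> (\<forall>u\<in>verts H. \<forall>v\<in>verts H. u \<rightarrow>\<^bsub>G\<^esub> v \<longrightarrow> c u \<noteq> c v)"
    by (simp add: proper_coloring_def dom)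
qed

lemma ex_induced_subgraph:
  assumes "wf_digraph G" "W \<subseteq> verts G"
  obtains H where "induced_subgraph H G" "verts H = W"
proof
  let ?H = "\<lparr>verts = W, arcs = {e \<in> arcs G. tail G e \<in> W \<and> head G e \<in> W},
    tail = tail G, head = head G\<rparr>"
  have "wf_digraph ?H"
    by unfold_locales auto
  then show "induced_subgraph ?H G"
    using assms by (auto simp: induced_subgraph_def subgraph_def compatible_def)
qed simp

text \<open>Trades induced subgraphs for vertex sets \<open>W\<close>, and the clique number for an
  arbitrary upper bound \<open>k\<close> on clique sizes. A bound is enough because colours below
  the clique number are also below \<open>k\<close>; conversely \<open>k\<close> may be taken to be
  the clique number itself.\<close>

lemma perfect_graph_iff:
  assumes "graph G"
  shows "perfect_graph G \<longleftrightarrow>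
    (\<forall>W k. W \<subseteq> verts G \<longrightarrow> (\<forall>K. K \<subseteq> W \<longrightarrow> clique G K \<longrightarrow> card K \<le> k) \<longrightarrow>
      (\<exists>c. (\<forall>v\<in>W. c v < k) \<and> (\<forall>u\<in>W. \<forall>v\<in>W. u \<rightarrow>\<^bsub>G\<^esub> v \<longrightarrow> c u \<noteq> c v)))"
    (is "_ \<longleftrightarrow> ?P")
proof -
  have digraphs: "wf_digraph G" "fin_digraph G" "loopfree_digraph G"
    using assms by (blast dest: graph.axioms digraph.axioms fin_digraph.axioms)+
  have finH: "finite (verts H)" if "induced_subgraph H G" for H
    using subgraph_imp_subverts[OF induced_imp_subgraph[OF that]] fin_digraph.finite_verts[OF digraphs(2)]
    by (rule finite_subset)
  have iff: "clique_number H = chromatic_number H \<longleftrightarrow>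
      (\<exists>c. proper_coloring H c (clique_number H))" if H: "induced_subgraph H G" for H
  proof (rule clique_number_eq_chromatic_number_iff[OF finH[OF H]])
    have "arcs_ends H \<subseteq> arcs_ends G"
      using H by (auto simp: induced_subgraph_def subgraph_def compatible_def arcs_ends_conv)
    then show "\<not> v \<rightarrow>\<^bsub>H\<^esub> v" for v
      using loopfree_digraph.adj_not_same[OF digraphs(3)] by blast
  qed
  show ?thesis
  proof
    assume perf: "perfect_graph G"
    show ?P
    proof (intro allI impI)
      fix W k assume W: "W \<subseteq> verts G" and k: "\<forall>K. K \<subseteq> W \<longrightarrow> clique G K \<longrightarrow> card K \<le> k"
      obtain H where H: "induced_subgraph H G" "verts H = W"
        using ex_induced_subgraph[OF digraphs(1) W] .
      obtain K where "clique H K" "card K = clique_number H"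
        using maximum_cliqueE[OF finH[OF H(1)]] by metis
      then have "clique_number H \<le> k"
        using k H induced_subgraph_clique_iff by metis
      moreover obtain c where "proper_coloring H c (clique_number H)"
        using perf H(1) iff unfolding perfect_graph_def by blast
      ultimately show "\<exists>c. (\<forall>v\<in>W. c v < k) \<and> (\<forall>u\<in>W. \<forall>v\<in>W. u \<rightarrow>\<^bsub>G\<^esub> v \<longrightarrow> c u \<noteq> c v)"
        unfolding induced_subgraph_proper_coloring_iff[OF H(1)] H(2)
        by (intro exI[of _ c]) (auto intro: order_less_le_trans)
    qed
  next
    assume P: ?P
    show "perfect_graph G"
      unfolding perfect_graph_def
    proof (intro allI impI)
      fix H assume H: "induced_subgraph H G"
      have "card K \<le> clique_number H" if "clique H K" for K
        using maximum_cliqueE[OF finH[OF H]] that by metis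
      then have "\<exists>c. proper_coloring H c (clique_number H)"
        unfolding induced_subgraph_proper_coloring_iff[OF H]
        by (intro P[rule_format])
          (auto intro: subgraph_imp_subverts[OF induced_imp_subgraph[OF H], THEN subsetD]
            simp: induced_subgraph_clique_iff[OF H])
      then show "clique_number H = chromatic_number H"
        using iff[OF H] by blast
    qed
  qed
qed

section \<open>The 5-cycle as an obstruction to perfection\<close>

lemma not_perfect_graph_if_induced_C5:
  assumes "graph G" "inj_on v {..<5::nat}" and verts: "v ` {..<5} \<subseteq> verts G"
    and adj: "\<And>i j. i < 5 \<Longrightarrow> j < 5 \<Longrightarrow> v i \<rightarrow>\<^bsub>G\<^esub> v j \<longleftrightarrow> j = Suc i mod 5 \<or> i = Suc j mod 5"
  shows "\<not> perfect_graph G"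
proof
  assume perf: "perfect_graph G"
  have clique_le: "card K \<le> 2" if K: "K \<subseteq> v ` {..<5}" "clique G K" for K
  proof (rule ccontr)
    assume "\<not> card K \<le> 2"
    then have "3 \<le> card K"
      by simp
    then obtain T where T: "T \<subseteq> K" "card T = 3"
      using obtain_subset_with_card_n by metis
    then obtain x y z where xyz: "T = {x, y, z}" "x \<noteq> y" "x \<noteq> z" "y \<noteq> z"
      by (auto simp: card_3_iff)
    moreover have "T \<subseteq> v ` {..<5}"
      using T(1) K(1) by (rule subset_trans)
    ultimately obtain a b c where abc: "x = v a" "y = v b" "z = v c" "a < 5" "b < 5" "c < 5"
      by auto
    then have "v a \<rightarrow>\<^bsub>G\<^esub> v b" "v b \<rightarrow>\<^bsub>G\<^esub> v c" "v c \<rightarrow>\<^bsub>G\<^esub> v a"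
      using T(1) K(2) xyz by (auto simp: clique_def)
    \<comment> \<open>A triangle would return to its start by three steps of 1 or -1 modulo 5, but
      such a sum is odd and at most 3 in absolute value, hence not divisible by 5.\<close>
    then have "b = Suc a mod 5 \<or> a = Suc b mod 5" "c = Suc b mod 5 \<or> b = Suc c mod 5"
        "a = Suc c mod 5 \<or> c = Suc a mod 5"
      using adj[OF abc(4,5)] adj[OF abc(5,6)] adj[OF abc(6,4)] abc(1-3) by metis+
    then show False
      using \<open>a < 5\<close> \<open>b < 5\<close> \<open>c < 5\<close> by (auto simp: mod_Suc split: if_splits)
  qed
  obtain c :: "'a \<Rightarrow> nat" where c: "\<forall>x\<in>v ` {..<5}. c x < 2"
      "\<forall>x\<in>v ` {..<5}. \<forall>y\<in>v ` {..<5}. x \<rightarrow>\<^bsub>G\<^esub> y \<longrightarrow> c x \<noteq> c y"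
    using perf[unfolded perfect_graph_iff[OF assms(1)], rule_format, OF verts clique_le] by auto
  have lt: "c (v i) < 2" if "i < 5" for i
    using c(1) that by simp
  \<comment> \<open>The colours are 0 and 1, so different colours are colours with sum 1, which
    makes the contradiction linear.\<close>
  have flip: "c (v i) + c (v (Suc i mod 5)) = 1" if "i < 5" for i
  proof -
    have "c (v i) \<noteq> c (v (Suc i mod 5))"
      using c(2) adj[of i "Suc i mod 5"] that by simp
    then show ?thesis
      using lt[OF that] lt[of "Suc i mod 5"] by simp
  qed
  have "c (v 0) + c (v 1) = 1"
    using flip[of 0] by simp
  moreover have "c (v 1) + c (v 2) = 1"
    using flip[of 1] by (simp del: One_nat_def add: Suc_1)
  moreover have "c (v 2) + c (v 3) = 1"
    using flip[of 2] by simp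
  moreover have "c (v 3) + c (v 4) = 1"
    using flip[of 3] by simp
  moreover have "c (v 4) + c (v 0) = 1"
    using flip[of 4] by simp
  \<comment> \<open>The alternating sum of the five equations; the odd length of the cycle makes
    \<open>c (v 0)\<close> survive twice.\<close>
  ultimately have "2 * c (v 0) = 1"
    by linarith
  then show False
    by (cases "c (v 0)") simp_all
qed

text \<open>If there are fewer than four prime factors, the infinitude of primes supplies others to
  fill up the list, with exponent 0. Conversely a prime dividing the product is one of the four;
  since exponents may vanish, this is only an inclusion, whence an upper bound on the number of
  factors.\<close>

lemma card_prime_factors_le_4_iff:
  fixes n :: nat
  assumes "n > 0"
  shows "card (prime_factors n) \<le> 4 \<longleftrightarrow>
    (\<exists>p1 p2 p3 p4 a1 a2 a3 a4 :: nat.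
      Factorial_Ring.prime p1 \<and> Factorial_Ring.prime p2 \<and>
      Factorial_Ring.prime p3 \<and> Factorial_Ring.prime p4 \<and>
      distinct [p1, p2, p3, p4] \<and>
      n = p1 ^ a1 * p2 ^ a2 * p3 ^ a3 * p4 ^ a4)" (is "_ \<longleftrightarrow> ?P")
proof
  assume le: "card (prime_factors n) \<le> 4"
  have "infinite ({p::nat. Factorial_Ring.prime p} - prime_factors n)"
    using primes_infinite by (simp add: Diff_infinite_finite)
  then obtain B where B: "finite B" "card B = 4 - card (prime_factors n)"
      "B \<subseteq> {p::nat. Factorial_Ring.prime p} - prime_factors n"
    using infinite_arbitrarily_large[of _ "4 - card (prime_factors n)"] by metis
  define P where "P = prime_factors n \<union> B"
  have P: "finite P" "\<And>p. p \<in> P \<Longrightarrow> Factorial_Ring.prime p"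
    using B by (auto simp: P_def)
  have "card P = 4"
    unfolding P_def using B le by (subst card_Un_disjoint) auto
  then obtain ps where "set ps = P" "distinct ps" "length ps = 4"
    using finite_distinct_list[OF P(1)] distinct_card by metis
  then obtain p1 p2 p3 p4 where ps: "P = {p1, p2, p3, p4}" "distinct [p1, p2, p3, p4]"
    by (auto simp: numeral_eq_Suc length_Suc_conv)
  have "n = (\<Prod>p\<in>prime_factors n. p ^ multiplicity p n)"
    using assms by (rule prime_factorization_nat)
  also have "\<dots> = (\<Prod>p\<in>P. p ^ multiplicity p n)"
  proof (rule prod.mono_neutral_left[OF P(1)])
    show "prime_factors n \<subseteq> P"
      by (simp add: P_def)
    show "\<forall>p\<in>P - prime_factors n. p ^ multiplicity p n = 1"
      using P(2) assms by (auto simp: prime_factors_dvd not_dvd_imp_multiplicity_0)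
  qed
  also have "\<dots> = p1 ^ multiplicity p1 n * p2 ^ multiplicity p2 n * p3 ^ multiplicity p3 n *
      p4 ^ multiplicity p4 n"
    using ps by (simp add: mult.assoc)
  finally have n_eq: "n = p1 ^ multiplicity p1 n * p2 ^ multiplicity p2 n *
      p3 ^ multiplicity p3 n * p4 ^ multiplicity p4 n" .
  have primes: "Factorial_Ring.prime p1" "Factorial_Ring.prime p2"
      "Factorial_Ring.prime p3" "Factorial_Ring.prime p4"
    using P(2) ps(1) by simp_all
  show ?P
    by (rule exI[of _ p1], rule exI[of _ p2], rule exI[of _ p3], rule exI[of _ p4],
        rule exI[of _ "multiplicity p1 n"], rule exI[of _ "multiplicity p2 n"],
        rule exI[of _ "multiplicity p3 n"], rule exI[of _ "multiplicity p4 n"])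
      (intro conjI primes ps(2) n_eq)
next
  assume ?P
  then obtain p1 p2 p3 p4 a1 a2 a3 a4 :: nat where p: "Factorial_Ring.prime p1"
      "Factorial_Ring.prime p2" "Factorial_Ring.prime p3" "Factorial_Ring.prime p4"
      "n = p1 ^ a1 * p2 ^ a2 * p3 ^ a3 * p4 ^ a4"
    by blast
  have "prime_factors n \<subseteq> set [p1, p2, p3, p4]"
  proof
    fix q assume "q \<in> prime_factors n"
    then have q: "Factorial_Ring.prime q" "q dvd p1 ^ a1 * p2 ^ a2 * p3 ^ a3 * p4 ^ a4"
      using p(5) by auto
    then have "q dvd p1 \<or> q dvd p2 \<or> q dvd p3 \<or> q dvd p4"
      by (auto simp: prime_dvd_mult_iff dest: prime_dvd_power)
    then show "q \<in> set [p1, p2, p3, p4]"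
      using q(1) p(1-4) by (auto dest: primes_dvd_imp_eq)
  qed
  then have "card (prime_factors n) \<le> card (set [p1, p2, p3, p4])"
    by (rule card_mono[rotated]) simp
  also have "\<dots> \<le> 4"
    using card_length[of "[p1, p2, p3, p4]"] by simp
  finally show "card (prime_factors n) \<le> 4" .
qed

section \<open>Residue classes, ideals of the residue ring and their labels\<close>

lemma ZMod_eq_coset: "ZMod k = (+>\<^bsub>\<Z>\<^esub>) (Idl\<^bsub>\<Z>\<^esub> {k})"
  by (simp add: fun_eq_iff ZMod_def)

text \<open>\<open>ZMod k\<close> is the quotient map, a surjective ring homomorphism whose kernel
  consists of the multiples of \<open>k\<close>. This allows computing with integer
  representatives.\<close>

lemma carrier_ZFact: "carrier (ZFact k) = range (ZMod k)"
  and ZMod_mult: "ZMod k a \<otimes>\<^bsub>ZFact k\<^esub> ZMod k b = ZMod k (a * b)"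
  and ZMod_eq_zero_iff: "ZMod k a = \<zero>\<^bsub>ZFact k\<^esub> \<longleftrightarrow> k dvd a"
proof -
  have "ideal (Idl\<^bsub>\<Z>\<^esub> {k}) \<Z>"
    by (rule int.genideal_ideal) simp
  then have hom: "ZMod k \<in> ring_hom \<Z> (ZFact k)"
    unfolding ZMod_eq_coset ZFact_def by (rule ideal.rcos_ring_hom)
  show "carrier (ZFact k) = range (ZMod k)"
    by (auto simp: ZFact_defs A_RCOSETS_def' ZMod_eq_coset)
  show "ZMod k a \<otimes>\<^bsub>ZFact k\<^esub> ZMod k b = ZMod k (a * b)"
    using ring_hom_mult[OF hom, of a b] by simp
  have "\<zero>\<^bsub>ZFact k\<^esub> = ZMod k 0"
    using ring_hom_zero[OF hom _ cring.axioms(1)[OF ZFact_is_cring]] int.ring_axioms by simp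
  then show "ZMod k a = \<zero>\<^bsub>ZFact k\<^esub> \<longleftrightarrow> k dvd a"
    by (auto simp: ZMod_eq_mod)
qed

lemma finite_carrier_ZFact:
  assumes "k > 0"
  shows "finite (carrier (ZFact k))"
proof -
  have "ZMod k a \<in> ZMod k ` {0..<k}" for a
    using assms by (subst ZMod_mod) simp
  then have "carrier (ZFact k) \<subseteq> ZMod k ` {0..<k}"
    by (auto simp: carrier_ZFact)
  then show ?thesis
    by (rule finite_subset) simp
qed

lemma ideal_ZFact_ZMod_dvd:
  assumes "ideal I (ZFact k)" "ZMod k a \<in> I" "a dvd b"
  shows "ZMod k b \<in> I"
proof -
  obtain c where "b = c * a"
    using assms(3) by (auto simp: dvd_def mult.commute)
  then show ?thesis
    using ideal.I_l_closed[OF assms(1,2), of "ZMod k c"] by (simp add: carrier_ZFact ZMod_mult)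
qed

text \<open>The minimal ideals, one of order \<open>p\<close> for each prime \<open>p\<close>
  dividing \<open>n\<close>, add up to the socle of the ring, hence the name. Testing the generator
  \<open>n div p\<close> suffices to decide whether an ideal contains the minimal ideal.\<close>

definition socle_primes :: "nat \<Rightarrow> int set set \<Rightarrow> nat set" where
  "socle_primes n I = {p \<in> prime_factors n. ZMod (int n) (int (n div p)) \<in> I}"

text \<open>A nonzero ideal contains a minimal one: if it contains the class of \<open>a\<close>,
  not divisible by \<open>n\<close>, then it contains the class of the proper divisor
  \<open>g = gcd a n\<close>, and for every prime \<open>p\<close> dividing \<open>n div g\<close>
  the number \<open>n div p\<close> is a multiple of \<open>g\<close>.\<close>

lemma socle_primes_eq_empty_iff:
  assumes "n > 0" "ideal I (ZFact (int n))"
  shows "socle_primes n I = {} \<longleftrightarrow> I = {\<zero>\<^bsub>ZFact (int n)\<^esub>}"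
proof
  assume empty: "socle_primes n I = {}"
  show "I = {\<zero>\<^bsub>ZFact (int n)\<^esub>}"
  proof (rule ccontr)
    assume "I \<noteq> {\<zero>\<^bsub>ZFact (int n)\<^esub>}"
    moreover have "\<zero>\<^bsub>ZFact (int n)\<^esub> \<in> I" "I \<subseteq> carrier (ZFact (int n))"
      using additive_subgroup.zero_closed[OF ideal.axioms(1)[OF assms(2)]]
        additive_subgroup.a_subset[OF ideal.axioms(1)[OF assms(2)]] by auto
    ultimately obtain x where "x \<in> I" "x \<noteq> \<zero>\<^bsub>ZFact (int n)\<^esub>" "x \<in> carrier (ZFact (int n))"
      by blast
    moreover from this(3) obtain a where "x = ZMod (int n) a"
      by (auto simp: carrier_ZFact)
    ultimately have a: "ZMod (int n) a \<in> I" "\<not> int n dvd a"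
      by (simp_all add: ZMod_eq_zero_iff)
    define g where "g = nat (gcd a (int n))"
    have g: "int g = gcd a (int n)" "g > 0"
      using assms(1) by (auto simp: g_def)
    have "g dvd n"
      using g(1) by (metis gcd_dvd2 int_dvd_int_iff)
    moreover have "g \<noteq> n"
      using g(1) a(2) by (metis gcd_dvd1)
    ultimately have "n div g \<noteq> 1"
      using assms(1) by (metis dvd_div_mult_self mult_1)
    then obtain p where p: "Factorial_Ring.prime p" "p dvd n div g"
      using prime_factor_nat by blast
    then have "p * g dvd n"
      using \<open>g dvd n\<close> by (metis dvd_div_mult_self dvd_refl mult_dvd_mono)
    then have "p dvd n" "g dvd n div p"
      using p(1) by (auto dest: dvd_mult_left simp: dvd_div_iff_mult mult.commute prime_gt_0_nat)
    \<comment> \<open>By Bezout \<open>g\<close> is congruent modulo \<open>n\<close> to a multiple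
      of \<open>a\<close>, so its class lies in \<open>I\<close>.\<close>
    obtain u v where "u * a + v * int n = int g"
      using bezout_int[of a "int n"] g(1) by auto
    then have "ZMod (int n) (u * a) = ZMod (int n) (int g)"
      by (metis ZMod_eq_mod mod_mult_self1)
    then have "ZMod (int n) (int g) \<in> I"
      using ideal_ZFact_ZMod_dvd[OF assms(2) a(1), of "u * a"] by simp
    then have "ZMod (int n) (int (n div p)) \<in> I"
      using ideal_ZFact_ZMod_dvd[OF assms(2)] \<open>g dvd n div p\<close> by (meson int_dvd_int_iff)
    then have "p \<in> socle_primes n I"
      using p(1) \<open>p dvd n\<close> assms(1) by (simp add: socle_primes_def prime_factors_dvd)
    then show False
      using empty by simp
  qed
next
  assume "I = {\<zero>\<^bsub>ZFact (int n)\<^esub>}"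
  \<comment> \<open>The generators of the minimal ideals are nonzero, so the zero ideal contains
    none of them.\<close>
  moreover have "\<not> n dvd n div p" if "p \<in> prime_factors n" for p
  proof
    have "p > 1" "p dvd n"
      using that by (auto intro: prime_gt_Suc_0_nat)
    assume "n dvd n div p"
    moreover have "0 < n div p" "n div p < n"
      using \<open>p > 1\<close> \<open>p dvd n\<close> assms(1) by (auto elim!: dvdE)
    ultimately show False
      by (simp add: nat_dvd_not_less)
  qed
  ultimately show "socle_primes n I = {}"
    by (auto simp: socle_primes_def ZMod_eq_zero_iff)
qed

text \<open>The label of \<open>I \<inter> J\<close> is the intersection of the two labels, straight
  from the definition; the emptiness criterion is then applied to the ideal
  \<open>I \<inter> J\<close>.\<close>

lemma intersection_graph_dominates_iff:
  assumes "n > 0"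
    and "I \<in> pverts (intersection_graph (ZFact (int n)))"
    and "J \<in> pverts (intersection_graph (ZFact (int n)))"
  shows "I \<rightarrow>\<^bsub>with_proj (intersection_graph (ZFact (int n)))\<^esub> J \<longleftrightarrow>
    I \<noteq> J \<and> socle_primes n I \<inter> socle_primes n J \<noteq> {}"
proof -
  have ideals: "ideal I (ZFact (int n))" "ideal J (ZFact (int n))"
    using assms(2,3) by (auto simp: intersection_graph_def)
  have "ideal (I \<inter> J) (ZFact (int n))"
    using ring.i_intersect[OF cring.axioms(1)[OF ZFact_is_cring] ideals] .
  moreover have "socle_primes n (I \<inter> J) = socle_primes n I \<inter> socle_primes n J"
    by (auto simp: socle_primes_def)
  ultimately show ?thesis
    using assms(2,3) socle_primes_eq_empty_iff[OF assms(1), of "I \<inter> J"]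
    by (simp add: intersection_graph_def)
qed

text \<open>This is the image of the principal ideal of \<open>m\<close> under the quotient map.
  Such ideals serve as the vertices of the 5-cycle.\<close>

lemma ideal_ZMod_multiples: "ideal (ZMod k ` {a. m dvd a}) (ZFact k)"
proof -
  have "Idl\<^bsub>\<Z>\<^esub> {m} = {a. m dvd a}"
    by (auto simp: int_Idl dvd_def mult.commute)
  moreover have "ideal (Idl\<^bsub>\<Z>\<^esub> {a}) \<Z>" for a
    by (rule int.genideal_ideal) simp
  note ring.ring_ideal_imp_quot_ideal[OF int.ring_axioms this[of k] this[of m]]
  ultimately show ?thesis
    by (simp add: ZMod_eq_coset ZFact_def)
qed

text \<open>The ideal generated by \<open>n div q\<close> contains the class of
  \<open>n div p\<close> iff \<open>n div q\<close> divides \<open>n div p\<close>, that is, iff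
  \<open>p\<close> divides \<open>q\<close>. Taking for \<open>q\<close> a product of distinct prime
  factors realises any prescribed label.\<close>

lemma socle_primes_multiples:
  assumes "n > 0" "q dvd n"
  shows "socle_primes n (ZMod (int n) ` {a. int (n div q) dvd a}) = {p \<in> prime_factors n. p dvd q}"
proof -
  have "ZMod (int n) (int (n div p)) \<in> ZMod (int n) ` {a. int (n div q) dvd a} \<longleftrightarrow> p dvd q"
    if "p \<in> prime_factors n" for p
  proof -
    have "p dvd n"
      using that by auto
    then obtain r s where rs: "n = p * r" "n = q * s"
      using assms(2) by (meson dvdE)
    then have pos: "p > 0" "q > 0" "r > 0" "s > 0"
      using assms(1) by (metis mult_is_0 not_gr_zero)+
    have "int (n div q) dvd int n"
      using assms(2) by (metis dvd_div_mult_self dvd_triv_left int_dvd_int_iff)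
    \<comment> \<open>As \<open>n div q\<close> divides the modulus, divisibility by it depends only
      on the residue class.\<close>
    then have dvd_cong: "int (n div q) dvd a \<longleftrightarrow> int (n div q) dvd b" if "a mod int n = b mod int n" for a b
      using that by (metis dvd_mod_iff)
    have "ZMod (int n) (int (n div p)) \<in> ZMod (int n) ` {a. int (n div q) dvd a} \<longleftrightarrow>
        n div q dvd n div p"
    proof
      assume "ZMod (int n) (int (n div p)) \<in> ZMod (int n) ` {a. int (n div q) dvd a}"
      then obtain a where "int (n div q) dvd a" "int (n div p) mod int n = a mod int n"
        by (elim imageE) (simp only: ZMod_eq_mod mem_Collect_eq)
      then show "n div q dvd n div p"
        using dvd_cong int_dvd_int_iff by blast
    next
      assume "n div q dvd n div p"
      then show "ZMod (int n) (int (n div p)) \<in> ZMod (int n) ` {a. int (n div q) dvd a}"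
        by (intro imageI) (simp only: mem_Collect_eq int_dvd_int_iff)
    qed
    also have "\<dots> \<longleftrightarrow> s dvd r"
      using rs pos by (metis nonzero_mult_div_cancel_left not_gr_zero)
    \<comment> \<open>Multiplying by \<open>p\<close> turns \<open>r\<close> into
      \<open>n = s * q\<close>, after which \<open>s\<close> cancels.\<close>
    also have "\<dots> \<longleftrightarrow> s * p dvd r * p"
      using pos by simp
    also have "\<dots> \<longleftrightarrow> s * p dvd s * q"
      using rs by (simp add: mult.commute)
    also have "\<dots> \<longleftrightarrow> p dvd q"
      using pos by simp
    finally show ?thesis .
  qed
  then show ?thesis
    by (auto simp: socle_primes_def)
qed

lemma graph_intersection_graph_ZFact:
  assumes "n > 0"
  shows "graph (with_proj (intersection_graph (ZFact (int n))))"
  using assms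
  by (intro pair_graph.pair_graphD_graph pair_graph_intersection_graph finite_carrier_ZFact) simp

section \<open>Colouring families of subsets of a set with at most four elements\<close>

text \<open>The colouring argument in terms of labels alone. The map \<open>S\<close> may be
  non-injective: different vertices with the same label meet and so need different colours.\<close>

lemma coloring_intersecting_setsE:
  fixes S :: "'v \<Rightarrow> 'p set"
  assumes "finite V" "finite P" "card P \<le> 4"
    and "\<And>v. v \<in> V \<Longrightarrow> S v \<subseteq> P" "\<And>v. v \<in> V \<Longrightarrow> S v \<noteq> {}"
    and "\<And>K. K \<subseteq> V \<Longrightarrow> pairwise (\<lambda>u v. S u \<inter> S v \<noteq> {}) K \<Longrightarrow> card K \<le> k"
  obtains c where "\<forall>v\<in>V. c v < k"
    "pairwise (\<lambda>u v. S u \<inter> S v \<noteq> {} \<longrightarrow> c u \<noteq> c v) V"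
proof -
  have "\<exists>c. (\<forall>v\<in>V. c v < k) \<and> pairwise (\<lambda>u v. S u \<inter> S v \<noteq> {} \<longrightarrow> c u \<noteq> c v) V"
    using assms(1,4,5,6)
  \<comment> \<open>The bound \<open>k\<close> is generalised because removing a disjoint pair
    lowers it by one.\<close>
  proof (induction "card V" arbitrary: V k rule: less_induct)
    case less
    note fin = less.prems(1) and sub = less.prems(2) and ne = less.prems(3) and cl = less.prems(4)
    let ?R = "\<lambda>u v. S u \<inter> S v \<noteq> {}"
    \<comment> \<open>The cases may overlap. They are exhaustive: if \<open>V\<close> is not a
      clique, two of its labels are disjoint.\<close>
    consider (singleton) v p where "v \<in> V" "S v = {p}"
      | (disjoint) u v where "\<And>w p. w \<in> V \<Longrightarrow> S w \<noteq> {p}" "u \<in> V" "v \<in> V" "S u \<inter> S v = {}"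
      | (clique) "pairwise ?R V"
      unfolding pairwise_def by blast
    then show ?case
    proof cases
      case singleton
      let ?W = "V - {v}"
      let ?N = "{w \<in> ?W. p \<in> S w}"
      have "card ?W < card V"
        using fin singleton(1) by (rule card_Diff1_less)
      then obtain c where c: "\<forall>w\<in>?W. c w < k" "pairwise (\<lambda>u w. ?R u w \<longrightarrow> c u \<noteq> c w) ?W"
        using less.hyps[of ?W k] fin sub ne cl[OF subset_trans[OF _ Diff_subset]] by auto
      \<comment> \<open>A label meets \<open>{p}\<close> iff it contains \<open>p\<close>, so
        \<open>v\<close> and its neighbours form a clique. Hence there are fewer than
        \<open>k\<close> neighbours and some colour below \<open>k\<close> is free for
        \<open>v\<close>.\<close>
      have "card (insert v ?N) \<le> k"
        by (rule cl) (use singleton in \<open>auto simp: pairwise_def\<close>)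
      then have "card ?N < k"
        using fin by simp
      then have "card (c ` ?N) < card {..<k}"
        using card_image_le[of ?N c] fin by simp
      moreover have "finite (c ` ?N)"
        using fin by simp
      ultimately have "\<not> {..<k} \<subseteq> c ` ?N"
        using card_mono leD by blast
      then obtain i where i: "i < k" "i \<notin> c ` ?N"
        by blast
      have "pairwise (\<lambda>u w. ?R u w \<longrightarrow> (c(v := i)) u \<noteq> (c(v := i)) w) V"
        using c(2) i(2) singleton(2) by (auto simp: pairwise_def)
      moreover have "\<forall>w\<in>V. (c(v := i)) w < k"
        using c(1) i(1) by simp
      ultimately show ?thesis
        by blast
    next
      case disjoint
      have two: "2 \<le> card (S w)" if "w \<in> V" for w
      proof -
        have "card (S w) \<noteq> 0" "card (S w) \<noteq> 1"
          using disjoint(1)[OF that] ne[OF that] finite_subset[OF sub[OF that] assms(2)]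
          by (auto simp: card_1_singleton_iff)
        then show ?thesis by simp
      qed
      \<comment> \<open>Here the bound 4 enters: two disjoint labels with at least two elements each
        exhaust \<open>P\<close>.\<close>
      have compl: "S w = P - S x" if "w \<in> V" "x \<in> V" "S w \<inter> S x = {}" for w x
      proof (rule card_seteq)
        show "finite (P - S x)"
          using assms(2) by simp
        show "S w \<subseteq> P - S x"
          using that sub by blast
        have "card (P - S x) = card P - card (S x)"
          using sub[OF that(2)] assms(2) by (meson card_Diff_subset finite_subset)
        then show "card (P - S x) \<le> card (S w)"
          using two[OF that(1)] two[OF that(2)] assms(3) by linarith
      qed
      have uv: "u \<noteq> v"
        using disjoint ne by blast
      let ?W = "V - {u, v}"
      \<comment> \<open>Every clique avoiding \<open>u\<close> and \<open>v\<close> can be extended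
        by one of them. Otherwise it contains \<open>w\<close> and \<open>x\<close> with labels
        disjoint from those of \<open>u\<close> and \<open>v\<close> respectively; taking
        complements gives \<open>S x = S u\<close>, so \<open>w\<close> and \<open>x\<close> do not
        meet.\<close>
      have clW: "card K \<le> k - 1" if K: "K \<subseteq> ?W" "pairwise ?R K" for K
      proof -
        have finK: "finite K"
          using K(1) fin by (metis finite_Diff finite_subset)
        have "\<exists>x\<in>{u, v}. \<forall>w\<in>K. ?R w x"
        proof (rule ccontr)
          assume "\<not> ?thesis"
          then obtain w x where w: "w \<in> K" "S w \<inter> S u = {}" and x: "x \<in> K" "S x \<inter> S v = {}"
            by auto
          have V: "w \<in> V" "x \<in> V"
            using w x K(1) by auto
          have "S x = S u"
            using compl[OF V(2) disjoint(3) x(2)] compl[OF disjoint(2-4)] by simp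
          then have "S w \<inter> S x = {}" "w \<noteq> x"
            using ne[OF V(1)] w(2) by auto
          then show False
            using K(2) w x by (auto simp: pairwise_def)
        qed
        then obtain x where x: "x \<in> {u, v}" "\<forall>w\<in>K. ?R w x"
          by blast
        have "card (insert x K) \<le> k"
        proof (rule cl)
          show "insert x K \<subseteq> V"
            using K(1) x(1) disjoint by blast
          show "pairwise ?R (insert x K)"
            using x(2) K(2) by (auto simp: pairwise_insert Int_commute)
        qed
        moreover have "x \<notin> K"
          using K(1) x(1) by blast
        ultimately show ?thesis
          using finK by simp
      qed
      \<comment> \<open>A one-vertex clique shows that \<open>k\<close> is positive, so that
        \<open>k - 1\<close> is a genuine predecessor and a legal colour.\<close>
      have "card {u} \<le> k"
        by (rule cl) (use disjoint in auto)
      then have k: "k \<noteq> 0"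
        by auto
      have "card ?W < card V"
        using fin disjoint by (intro psubset_card_mono) auto
      then obtain c where c: "\<forall>w\<in>?W. c w < k - 1"
          "pairwise (\<lambda>u w. ?R u w \<longrightarrow> c u \<noteq> c w) ?W"
        using less.hyps[of ?W "k - 1"] fin sub ne clW by auto
      \<comment> \<open>The colour \<open>k - 1\<close> does not occur on \<open>?W\<close>, and
        \<open>u\<close> and \<open>v\<close> can share it because their labels are
        disjoint.\<close>
      let ?c = "c(u := k - 1, v := k - 1)"
      have "?c x \<noteq> ?c y" if "x \<in> V" "y \<in> V" "x \<noteq> y" "?R x y" for x y
      proof (cases "x \<in> {u, v} \<or> y \<in> {u, v}")
        case True
        then have "x \<notin> {u, v} \<or> y \<notin> {u, v}"
          using that disjoint(4) by (auto simp: Int_commute)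
        moreover have "?c z < k - 1" if "z \<in> V" "z \<notin> {u, v}" for z
          using c(1) that by simp
        moreover have "?c u = k - 1" "?c v = k - 1"
          by simp_all
        ultimately show ?thesis
          using True that(1,2) by (metis insertE nless_le singletonD)
      next
        case False
        then show ?thesis
          using c(2) that by (simp add: pairwise_def)
      qed
      then have "pairwise (\<lambda>u w. ?R u w \<longrightarrow> ?c u \<noteq> ?c w) V"
        by (simp add: pairwise_def)
      moreover have "?c w < k" if "w \<in> V" for w
        using k that c(1)[rule_format, of w] by auto
      ultimately show ?thesis
        by blast
    next
      case clique
      then have "card V \<le> k"
        using cl by simp
      moreover obtain h where "bij_betw h V {0..<card V}"
        using ex_bij_betw_finite_nat[OF fin] by blast
      then have "inj_on h V" "\<And>v. v \<in> V \<Longrightarrow> h v < card V"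
        by (auto simp: bij_betw_def)
      ultimately show ?thesis
        by (intro exI[of _ h]) (auto simp: pairwise_def inj_on_eq_iff intro: order_less_le_trans)
    qed
  qed
  then show thesis
    using that by blast
qed

section \<open>Perfection of the intersection graph for the integers modulo n\<close>

theorem mainTheorem1:
  fixes n :: nat
  assumes "n > 0"
  shows "(perfect_graph (with_proj (intersection_graph (ZFact (int n)))) \<longleftrightarrow>
           (\<exists>p1 p2 p3 p4 a1 a2 a3 a4 :: nat.
              Factorial_Ring.prime p1 \<and> Factorial_Ring.prime p2 \<and>
              Factorial_Ring.prime p3 \<and> Factorial_Ring.prime p4 \<and>
              distinct [p1, p2, p3, p4] \<and>
              n = p1 ^ a1 * p2 ^ a2 * p3 ^ a3 * p4 ^ a4)) \<and>
         (perfect_graph (with_proj (intersection_graph (ZFact (int n)))) \<longleftrightarrow>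
           card (prime_factors n) \<le> 4)"
proof -
  let ?G = "with_proj (intersection_graph (ZFact (int n)))"
  have graph: "graph ?G"
    using assms by (rule graph_intersection_graph_ZFact)
  have "perfect_graph ?G" if four: "card (prime_factors n) \<le> 4"
  proof -
    have "finite (verts ?G)"
      using graph by (intro fin_digraph.finite_verts digraph.axioms(1) graph.axioms(1))
    show ?thesis
      unfolding perfect_graph_iff[OF graph]
    proof (intro allI impI)
      fix W k assume W: "W \<subseteq> verts ?G" and k: "\<forall>K. K \<subseteq> W \<longrightarrow> clique ?G K \<longrightarrow> card K \<le> k"
      have adj: "I \<rightarrow>\<^bsub>?G\<^esub> J \<longleftrightarrow> I \<noteq> J \<and> socle_primes n I \<inter> socle_primes n J \<noteq> {}"
        if "I \<in> W" "J \<in> W" for I J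
        using that W assms by (intro intersection_graph_dominates_iff) auto
      \<comment> \<open>The labels are subsets of the set of prime factors, which has at most four
        elements, and cliques inside \<open>W\<close> are the sets of ideals with pairwise meeting
        labels.\<close>
      obtain c where "\<forall>I\<in>W. c I < k"
          "pairwise (\<lambda>I J. socle_primes n I \<inter> socle_primes n J \<noteq> {} \<longrightarrow> c I \<noteq> c J) W"
      proof (rule coloring_intersecting_setsE)
        show "finite W"
          using W \<open>finite (verts ?G)\<close> by (rule finite_subset)
        show "finite (prime_factors n)" "card (prime_factors n) \<le> 4"
          using four by simp_all
        show "socle_primes n I \<subseteq> prime_factors n" for I
          by (auto simp: socle_primes_def)
        show "socle_primes n I \<noteq> {}" if "I \<in> W" for I
        proof -
          have "I \<in> verts ?G"
            using that W by blast
          then show ?thesis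
            using socle_primes_eq_empty_iff[OF assms, of I] by (auto simp: intersection_graph_def)
        qed
        show "card K \<le> k"
          if "K \<subseteq> W" "pairwise (\<lambda>I J. socle_primes n I \<inter> socle_primes n J \<noteq> {}) K" for K
        proof -
          have "clique ?G K"
            unfolding clique_def using that W adj by (meson pairwiseD subset_trans subsetD)
          then show ?thesis
            using k that(1) by blast
        qed
      qed
      then show "\<exists>c. (\<forall>I\<in>W. c I < k) \<and> (\<forall>I\<in>W. \<forall>J\<in>W. I \<rightarrow>\<^bsub>?G\<^esub> J \<longrightarrow> c I \<noteq> c J)"
        using adj by (intro exI[of _ c]) (simp add: pairwise_def)
    qed
  qed
  moreover have "\<not> perfect_graph ?G" if five: "card (prime_factors n) \<ge> 5"
  proof -
    obtain P where P: "P \<subseteq> prime_factors n" "card P = 5" "finite P"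
      using obtain_subset_with_card_n[OF five] by metis
    then obtain f :: "nat \<Rightarrow> nat" where "bij_betw f {0..<5} P"
      using ex_bij_betw_nat_finite by metis
    then have inj: "inj_on f {..<5}" and "f ` {..<5} \<subseteq> prime_factors n"
      using P(1) by (auto simp: bij_betw_def lessThan_atLeast0)
    then have f: "f i \<in> prime_factors n" if "i < 5" for i
      using that by auto
    have f_eq: "f i = f j \<longleftrightarrow> i = j" if "i < 5" "j < 5" for i j
      using inj that by (simp add: inj_on_eq_iff)
    \<comment> \<open>The label of \<open>I i\<close> is to be the edge from \<open>f i\<close> to
      the next prime in a pentagon on five primes. Edges of a pentagon meet exactly when they are
      equal or consecutive, so they again form a 5-cycle.\<close>
    define I where "I i = ZMod (int n) ` {a. int (n div (f i * f (Suc i mod 5))) dvd a}" for i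
    have socle: "socle_primes n (I i) = {f i, f (Suc i mod 5)}" if i: "i < 5" for i
    proof -
      let ?j = "Suc i mod 5"
      have j: "?j < 5" "f i \<noteq> f ?j"
        using i f_eq[of i ?j] by (auto simp: mod_Suc)
      have primes: "Factorial_Ring.prime (f i)" "f i dvd n" "Factorial_Ring.prime (f ?j)" "f ?j dvd n"
        using f[OF i] f[OF j(1)] by auto
      then have "f i * f ?j dvd n"
        using j(2) by (intro divides_mult) (auto intro: primes_coprime)
      then have "socle_primes n (I i) = {p \<in> prime_factors n. p dvd f i * f ?j}"
        unfolding I_def by (rule socle_primes_multiples[OF assms])
      also have "\<dots> = {f i, f ?j}"
      proof -
        have "p dvd f i * f ?j \<longleftrightarrow> p = f i \<or> p = f ?j" if "p \<in> prime_factors n" for p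
          using in_prime_factors_imp_prime[OF that] primes primes_dvd_imp_eq
          by (metis dvd_refl prime_dvd_mult_iff)
        then show ?thesis
          using f[OF i] f[OF j(1)] by blast
      qed
      finally show ?thesis .
    qed
    have I: "I i \<in> verts ?G" if i: "i < 5" for i
    proof -
      have "ideal (I i) (ZFact (int n))"
        unfolding I_def by (rule ideal_ZMod_multiples)
      moreover have "I i \<noteq> {\<zero>\<^bsub>ZFact (int n)\<^esub>}"
        using socle_primes_eq_empty_iff[OF assms calculation] socle[OF i] by simp
      \<comment> \<open>The label of the whole ring has at least five primes, that of
        \<open>I i\<close> only two.\<close>
      moreover have "I i \<noteq> carrier (ZFact (int n))"
      proof
        assume "I i = carrier (ZFact (int n))"
        then have "socle_primes n (I i) = prime_factors n"
          by (auto simp: socle_primes_def carrier_ZFact)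
        then have "card (prime_factors n) \<le> 2"
          unfolding socle[OF i] using card_insert_le_m1[of 2 "{f (Suc i mod 5)}" "f i"] by simp
        then show False
          using five by simp
      qed
      ultimately show ?thesis
        by (simp add: intersection_graph_def)
    qed
    have meet: "socle_primes n (I i) \<inter> socle_primes n (I j) \<noteq> {} \<longleftrightarrow>
        i = j \<or> j = Suc i mod 5 \<or> i = Suc j mod 5" if "i < 5" "j < 5" for i j
    proof -
      have "socle_primes n (I i) \<inter> socle_primes n (I j) \<noteq> {} \<longleftrightarrow>
          i = j \<or> i = Suc j mod 5 \<or> Suc i mod 5 = j \<or> Suc i mod 5 = Suc j mod 5"
        using that by (auto simp: socle f_eq)
      moreover have "Suc i mod 5 = Suc j mod 5 \<longleftrightarrow> i = j"
        using that by (auto simp: mod_Suc)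
      ultimately show ?thesis
        by blast
    qed
    have I_inj: "inj_on I {..<5}"
    proof (rule inj_onI)
      fix i j assume ij: "i \<in> {..<5::nat}" "j \<in> {..<5::nat}" "I i = I j"
      then have "{f i, f (Suc i mod 5)} = {f j, f (Suc j mod 5)}"
        using socle by (metis lessThan_iff)
      \<comment> \<open>The second alternative, two edges with swapped ends, would force 2 to be
        divisible by 5.\<close>
      then have "i = j \<or> i = Suc j mod 5 \<and> j = Suc i mod 5"
        using ij f_eq by (auto simp: doubleton_eq_iff)
      then show "i = j"
        using ij by (auto simp: mod_Suc split: if_splits)
    qed
    show ?thesis
    proof (rule not_perfect_graph_if_induced_C5[OF graph I_inj])
      show "I ` {..<5} \<subseteq> verts ?G"
        using I by auto
      fix i j :: nat assume ij: "i < 5" "j < 5"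
      have "I i \<noteq> I j \<longleftrightarrow> i \<noteq> j"
        using I_inj ij by (simp add: inj_on_eq_iff)
      \<comment> \<open>For \<open>i = j\<close> both sides of the adjacency condition must fail:
        the graph has no loops, and no index is its own cyclic successor.\<close>
      moreover have "i \<noteq> Suc i mod 5"
        using ij by (auto simp: mod_Suc)
      ultimately show "I i \<rightarrow>\<^bsub>?G\<^esub> I j \<longleftrightarrow> j = Suc i mod 5 \<or> i = Suc j mod 5"
        using intersection_graph_dominates_iff[OF assms] I[OF ij(1)] I[OF ij(2)] meet[OF ij] by auto
    qed
  qed
  ultimately have "perfect_graph ?G \<longleftrightarrow> card (prime_factors n) \<le> 4"
    by linarith
  then show ?thesis
    using card_prime_factors_le_4_iff[OF assms] by simp
qed

end
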